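(* Let $(X,\tau)$ be a metrizable space and let $F=\{a_1,\dots,a_k\}\subseteq X$ be a set of $k$ distinct points, $2\le k<\infty$. Let $s,t\in\mathcal G_F(\tau)$ and let $m=(m_1,\dots,m_k)$ with $m_i=\min\{s_i,t_i\}$. Then $$\tau_s\cap\tau_t=\nu_m.$$ No compatibility assumption on $m$ is required.
   Context: A compatible gauge system at $F$ is a $k$-tuple $s=(s_1,\dots,s_k)$ of $\tau$-continuous functions $s_i:X\to[0,1]$ with $s_i^{-1}(0)=\{a_i\}$ for all $i$ and (compatibility) $\inf_{x\in X}\max\{s_i(x),s_j(x)\}>0$ for all $i\ne j$. $\mathcal G_F(\tau)$ is the class of all compatible gauge systems at $F$. For any $k$-tuple $r=(r_1,\dots,r_k)$ of $\tau$-continuous functions $r_i:X\to[0,1]$ with $r_i^{-1}(0)=\{a_i\}$ (compatible or not), $\nu_r$ is the topology on $X$ in which $U\subseteq X$ is open exactly when $U\in\tau$ and, for every $i$ with $a_i\in U$, there is $\varepsilon_i>0$ such that $\{x: r_i(x)<\varepsilon_i\}\subseteq U$. For $s\in\mathcal G_F(\tau)$ one writes $\tau_s=\nu_s$. *)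

theory Defs
  imports "HOL-Analysis.Analysis"
begin

text \<open>
  The distinguished points are enumerated as \<open>a 1, \<dots>, a k\<close>, and a \<open>k\<close>-tuple of functions on
  \<open>topspace X\<close> is a family \<open>r\<close> of which only \<open>r 1, \<dots>, r k\<close>, restricted to \<open>topspace X\<close>, matter.
\<close>

definition gauge_tuple :: "'a topology \<Rightarrow> nat \<Rightarrow> (nat \<Rightarrow> 'a) \<Rightarrow> (nat \<Rightarrow> 'a \<Rightarrow> real) \<Rightarrow> bool" where
  "gauge_tuple X k a r \<longleftrightarrow>
     (\<forall>i\<in>{1..k}. continuous_map X euclideanreal (r i) \<and>
                 r i ` topspace X \<subseteq> {0..1} \<and>
                 {x \<in> topspace X. r i x = 0} = {a i})"

definition compatible_gauge_systems ::
    "'a topology \<Rightarrow> nat \<Rightarrow> (nat \<Rightarrow> 'a) \<Rightarrow> (nat \<Rightarrow> 'a \<Rightarrow> real) set" where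
  "compatible_gauge_systems X k a =
     {s. gauge_tuple X k a s \<and>
         (\<forall>i\<in>{1..k}. \<forall>j\<in>{1..k}. i \<noteq> j \<longrightarrow> (INF x\<in>topspace X. max (s i x) (s j x)) > 0)}"

definition gauge_topology ::
    "'a topology \<Rightarrow> nat \<Rightarrow> (nat \<Rightarrow> 'a) \<Rightarrow> (nat \<Rightarrow> 'a \<Rightarrow> real) \<Rightarrow> 'a topology" where
  "gauge_topology X k a r =
     topology (\<lambda>U. openin X U \<and>
       (\<forall>i\<in>{1..k}. a i \<in> U \<longrightarrow> (\<exists>\<epsilon>>0. {x \<in> topspace X. r i x < \<epsilon>} \<subseteq> U)))"

lemma istopology_gauge:
  "istopology (\<lambda>U. openin X U \<and>
       (\<forall>i\<in>{1..k}. a i \<in> U \<longrightarrow> (\<exists>\<epsilon>>0. {x \<in> topspace X. (r :: nat \<Rightarrow> 'a \<Rightarrow> real) i x < \<epsilon>} \<subseteq> U)))"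
  (is "istopology ?P")
  unfolding istopology_def
proof (rule conjI; (rule allI)+)
  fix S T
  show "?P S \<longrightarrow> ?P T \<longrightarrow> ?P (S \<inter> T)"
  proof (rule impI)+
    assume S: "?P S" and T: "?P T"
    have "\<exists>\<epsilon>>0. {x \<in> topspace X. r i x < \<epsilon>} \<subseteq> S \<inter> T" if i: "i \<in> {1..k}" "a i \<in> S \<inter> T" for i
    proof -
      obtain d e where "d > 0" "{x \<in> topspace X. r i x < d} \<subseteq> S"
        and "e > 0" "{x \<in> topspace X. r i x < e} \<subseteq> T"
        using S T i by blast
      then show ?thesis by (intro exI[of _ "min d e"]) auto
    qed
    then show "?P (S \<inter> T)" using S T by (blast intro: openin_Int)
  qed
next
  fix K
  show "(\<forall>S\<in>K. ?P S) \<longrightarrow> ?P (\<Union>K)"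
  proof (rule impI)
    assume K: "\<forall>S\<in>K. ?P S"
    have "\<exists>\<epsilon>>0. {x \<in> topspace X. r i x < \<epsilon>} \<subseteq> \<Union>K" if i: "i \<in> {1..k}" "a i \<in> \<Union>K" for i
    proof -
      obtain S where "S \<in> K" "a i \<in> S" using i by blast
      then obtain d where "d > 0" "{x \<in> topspace X. r i x < d} \<subseteq> S" using K i by blast
      with \<open>S \<in> K\<close> show ?thesis by blast
    qed
    then show "?P (\<Union>K)" using K by (blast intro: openin_Union)
  qed
qed

lemma openin_gauge_topology:
  "openin (gauge_topology X k a r) U \<longleftrightarrow>
     openin X U \<and>
     (\<forall>i\<in>{1..k}. a i \<in> U \<longrightarrow> (\<exists>\<epsilon>>0. {x \<in> topspace X. r i x < \<epsilon>} \<subseteq> U))"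
  unfolding gauge_topology_def using istopology_gauge[of X k a r]
  by (simp add: topology_inverse')

lemma gauge_tuple_min:
  assumes "gauge_tuple X k a s" and "gauge_tuple X k a t"
  shows "gauge_tuple X k a (\<lambda>i x. min (s i x) (t i x))"
  unfolding gauge_tuple_def
proof (intro ballI conjI)
  fix i assume i: "i \<in> {1..k}"
  note s = assms(1)[unfolded gauge_tuple_def, rule_format, OF i]
  note t = assms(2)[unfolded gauge_tuple_def, rule_format, OF i]
  show "continuous_map X euclideanreal (\<lambda>x. min (s i x) (t i x))"
    using s t by (intro continuous_map_real_min) auto
  show "(\<lambda>x. min (s i x) (t i x)) ` topspace X \<subseteq> {0..1}"
    using s t by (auto simp: min_def image_subset_iff)
  have "0 \<le> s i x \<and> 0 \<le> t i x" if "x \<in> topspace X" for x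
    using s t that by (auto simp: image_subset_iff)
  then have "min (s i x) (t i x) = 0 \<longleftrightarrow> s i x = 0 \<or> t i x = 0" if "x \<in> topspace X" for x
    using that by (smt (verit))
  then have "{x \<in> topspace X. min (s i x) (t i x) = 0} =
      {x \<in> topspace X. s i x = 0} \<union> {x \<in> topspace X. t i x = 0}"
    by blast
  then show "{x \<in> topspace X. min (s i x) (t i x) = 0} = {a i}"
    using s t by simp
qed

end

theory Submission
  imports Defs
begin

text \<open>
  A set is open at a distinguished point \<open>a i\<close> when it contains a strict sublevel set of the
  \<open>i\<close>-th gauge. The strict sublevel sets of a pointwise minimum are the unions of those of the two
  functions at the same height, so a set containing one for the minimum contains one for each
  function. Conversely, if it contains one at height \<open>d\<close> for \<open>s i\<close> and one at height \<open>e\<close> for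
  \<open>t i\<close>, then, because sublevel sets shrink with the height, it contains both at the common height
  \<open>min d e\<close>, and hence their union.
\<close>

lemma sublevel_min_subset_iff:
  fixes f g :: "'a \<Rightarrow> real"
  shows "(\<exists>\<epsilon>>0. {x \<in> A. min (f x) (g x) < \<epsilon>} \<subseteq> U) \<longleftrightarrow>
         (\<exists>\<epsilon>>0. {x \<in> A. f x < \<epsilon>} \<subseteq> U) \<and> (\<exists>\<epsilon>>0. {x \<in> A. g x < \<epsilon>} \<subseteq> U)"
    (is "?M \<longleftrightarrow> ?F \<and> ?G")
proof
  assume ?M
  then show "?F \<and> ?G"
    by (auto simp: min_less_iff_disj)
next
  assume "?F \<and> ?G"
  then obtain d e where "d > 0" "{x \<in> A. f x < d} \<subseteq> U" "e > 0" "{x \<in> A. g x < e} \<subseteq> U"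
    by blast
  moreover have "{x \<in> A. min (f x) (g x) < min d e} \<subseteq> {x \<in> A. f x < d} \<union> {x \<in> A. g x < e}"
    by (auto simp: min_def split: if_splits)
  ultimately show ?M
    by (intro exI[of _ "min d e"]) auto
qed

lemma openin_gauge_topology_min:
  "openin (gauge_topology X k a (\<lambda>i x. min (s i x) (t i x))) U \<longleftrightarrow>
   openin (gauge_topology X k a s) U \<and> openin (gauge_topology X k a t) U"
  unfolding openin_gauge_topology sublevel_min_subset_iff by blast

theorem lemma5p2:
  fixes X :: "'a topology" and k :: nat and a :: "nat \<Rightarrow> 'a"
    and s t :: "nat \<Rightarrow> 'a \<Rightarrow> real"
  assumes "metrizable_space X"
    and "2 \<le> k"
    and "inj_on a {1..k}"
    and "a ` {1..k} \<subseteq> topspace X"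
    and "s \<in> compatible_gauge_systems X k a"
    and "t \<in> compatible_gauge_systems X k a"
  shows "{U. openin (gauge_topology X k a s) U} \<inter> {U. openin (gauge_topology X k a t) U} =
         {U. openin (gauge_topology X k a (\<lambda>i x. min (s i x) (t i x))) U}"
  by (auto simp: openin_gauge_topology_min)

end
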